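(* The admissible state set $\mathcal G$ is equal to the set $$\mathcal G_0=\Big\{\mathbf U=(D,\mathbf m,\mathbf B,E)^\top\in\mathbb R^8\ \Big|\ D>0,\ q(\mathbf U)>0,\ \Psi(\mathbf U)>0\Big\},$$ where $$q(\mathbf U)=E-\sqrt{D^2+|\mathbf m|^2},\qquad \Phi(\mathbf U)=\sqrt{(|\mathbf B|^2-E)^2+3(E^2-D^2-|\mathbf m|^2)},$$ $$\Psi(\mathbf U)=\Big(\Phi(\mathbf U)-2(|\mathbf B|^2-E)\Big)\sqrt{\Phi(\mathbf U)+|\mathbf B|^2-E}-\sqrt{\tfrac{27}{2}\big(D^2|\mathbf B|^2+(\mathbf m\cdot\mathbf B)^2\big)}.$$
   Context: Fix the adiabatic index $\Gamma\in(1,2]$ (equation of state $p=(\Gamma-1)\rho e$; speed of light $c=1$). For primitive variables $\mathbf V=(\rho,\mathbf v,\mathbf B,p)$ with $\rho,p>0$, $\mathbf v,\mathbf B\in\mathbb R^3$, $|\mathbf v|<1$, put $W=(1-|\mathbf v|^2)^{-1/2}$, $e=\frac{p}{(\Gamma-1)\rho}$, $h=1+e+\frac p\rho$, $p_m=\frac12\big(W^{-2}|\mathbf B|^2+(\mathbf v\cdot\mathbf B)^2\big)$, $p_{tot}=p+p_m$. The associated conservative vector is $\mathbf U(\mathbf V)=(D,\mathbf m,\mathbf B,E)^\top\in\mathbb R^8$ with $$D=\rho W,\quad \mathbf m=\rho hW^2\mathbf v+|\mathbf B|^2\mathbf v-(\mathbf v\cdot\mathbf B)\mathbf B,\quad E=\rho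 hW^2-p_{tot}+|\mathbf B|^2.$$ The admissible state set $\mathcal G$ is the set of all $\mathbf U=(D,\mathbf m,\mathbf B,E)^\top\in\mathbb R^8$ whose primitive variables satisfy $\rho(\mathbf U)>0$, $p(\mathbf U)>0$, $|\mathbf v(\mathbf U)|<1$; i.e. $\mathcal G=\{\mathbf U(\mathbf V): \rho>0,\ p>0,\ |\mathbf v|<1,\ \mathbf B\in\mathbb R^3\}$. The third condition in $\mathcal G_0$ is imposed for $\mathbf U$ satisfying the first two, for which the square roots are of nonnegative numbers. *)

theory Defs
  imports "HOL-Analysis.Analysis"
begin

text \<open>
  The space R^8 of conservative vectors is written in the block form
  U = (D, m, B, E), and primitive variables likewise as V = (rho, v, B, p).
\<close>

type_synonym conservative = "real \<times> (real^3) \<times> (real^3) \<times> real"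
type_synonym primitive = "real \<times> (real^3) \<times> (real^3) \<times> real"

definition lorentz_factor :: "real^3 \<Rightarrow> real" where
  "lorentz_factor v = 1 / sqrt (1 - (norm v)\<^sup>2)"

definition internal_energy :: "real \<Rightarrow> real \<Rightarrow> real \<Rightarrow> real" where
  "internal_energy \<Gamma> \<rho> p = p / ((\<Gamma> - 1) * \<rho>)"

definition enthalpy :: "real \<Rightarrow> real \<Rightarrow> real \<Rightarrow> real" where
  "enthalpy \<Gamma> \<rho> p = 1 + internal_energy \<Gamma> \<rho> p + p / \<rho>"

definition magnetic_pressure :: "real^3 \<Rightarrow> real^3 \<Rightarrow> real" where
  "magnetic_pressure v B = ((norm B)\<^sup>2 / (lorentz_factor v)\<^sup>2 + (v \<bullet> B)\<^sup>2) / 2"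

definition total_pressure :: "real^3 \<Rightarrow> real^3 \<Rightarrow> real \<Rightarrow> real" where
  "total_pressure v B p = p + magnetic_pressure v B"

fun conservative_of :: "real \<Rightarrow> primitive \<Rightarrow> conservative" where
  "conservative_of \<Gamma> (\<rho>, v, B, p) =
    (let W = lorentz_factor v; h = enthalpy \<Gamma> \<rho> p in
      (\<rho> * W,
       (\<rho> * h * W\<^sup>2) *\<^sub>R v + (norm B)\<^sup>2 *\<^sub>R v - (v \<bullet> B) *\<^sub>R B,
       B,
       \<rho> * h * W\<^sup>2 - total_pressure v B p + (norm B)\<^sup>2))"

definition admissible :: "real \<Rightarrow> conservative set" where
  "admissible \<Gamma> =
    {conservative_of \<Gamma> (\<rho>, v, B, p) | \<rho> v B p. \<rho> > 0 \<and> p > 0 \<and> norm v < 1}"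

fun q :: "conservative \<Rightarrow> real" where
  "q (D, m, B, E) = E - sqrt (D\<^sup>2 + (norm m)\<^sup>2)"

fun \<Phi> :: "conservative \<Rightarrow> real" where
  "\<Phi> (D, m, B, E) = sqrt (((norm B)\<^sup>2 - E)\<^sup>2 + 3 * (E\<^sup>2 - D\<^sup>2 - (norm m)\<^sup>2))"

fun \<Psi> :: "conservative \<Rightarrow> real" where
  "\<Psi> (D, m, B, E) =
    (\<Phi> (D, m, B, E) - 2 * ((norm B)\<^sup>2 - E)) * sqrt (\<Phi> (D, m, B, E) + (norm B)\<^sup>2 - E)
    - sqrt (27 / 2 * (D\<^sup>2 * (norm B)\<^sup>2 + (m \<bullet> B)\<^sup>2))"

text \<open>
  The real square root is total, with sqrt (-x) = - sqrt x.  The first two conditions below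
  make the arguments of all square roots in the third one nonnegative, since q U > 0 gives
  E^2 > D^2 + |m|^2 and hence Phi U > | |B|^2 - E |.
\<close>

definition G0 :: "conservative set" where
  "G0 = {(D, m, B, E) | D m B E. D > 0 \<and> q (D, m, B, E) > 0 \<and> \<Psi> (D, m, B, E) > 0}"

end

theory Submission
  imports Defs
begin

text \<open>
  The proof parametrises the states with given conserved data by the single number
  \<open>x = \<rho> h W\<^sup>2\<close>. Write \<open>M = |m|\<^sup>2\<close>, \<open>b = |B|\<^sup>2\<close>, \<open>s = m \<bullet> B\<close>. Once \<open>x > 0\<close> is known, the momentum
  equation is linear in the velocity and determines it. Its square \<open>u(x)\<close> depends on \<open>M\<close>, \<open>b\<close>, \<open>s\<close>
  only and is nonincreasing in \<open>x\<close>. The density is then \<open>D \<surd>(1 - u)\<close>, the equation of state gives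
  the pressure \<open>k (x (1 - u) - D \<surd>(1 - u))\<close> with \<open>k = (\<Gamma> - 1) / \<Gamma> \<in> (0, 1/2]\<close>, and the pressure
  is positive exactly if the strictly increasing function \<open>gap x = 1 - u - D\<^sup>2 / x\<^sup>2\<close> is. So the state is
  admissible iff \<open>D > 0\<close> and the energy equation \<open>energy k x = E\<close> has a solution in the region
  where \<open>gap\<close> is positive (\<open>admissible_iff\<close>).

  The equation of state is removed next. Setting the pressure to zero, that is, replacing
  \<open>1 - u\<close> by \<open>D\<^sup>2 / x\<^sup>2\<close>, turns the energy into a function \<open>cold_energy\<close> that no longer involves
  \<open>\<Gamma>\<close>. It lies strictly above \<open>energy k\<close> where \<open>gap\<close> is positive and meets it where \<open>gap\<close>
  vanishes. As \<open>energy k\<close> is strictly increasing where \<open>u < 1\<close> (here \<open>\<Gamma> \<le> 2\<close> enters) and unbounded, the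
  intermediate value theorem shows that \<open>energy k x = E\<close> is solvable in this region iff
  \<open>cold_energy x = E\<close> is (\<open>exists_energy_iff_exists_cold_energy\<close>).

  Finally, with \<open>a = b - E\<close> and \<open>T = (b D\<^sup>2 + s\<^sup>2) / 2\<close> the equation \<open>cold_energy x = E\<close> is the cubic
  \<open>x\<^sup>2 (x + a) = T\<close>. Modulo this cubic the sign of \<open>gap x\<close>, a quartic condition, becomes that of a
  concave quadratic polynomial whose larger root is \<open>z = (\<Phi> - 2 a) / 3\<close>. A positive root of the cubic
  with positive \<open>gap\<close> forces \<open>q > 0\<close>. Conversely, if \<open>q > 0\<close>, then the positive root of the cubic has
  positive \<open>gap\<close> iff it lies below \<open>z\<close>, that is, iff \<open>z > 0\<close> and \<open>z\<^sup>2 (z + a) > T\<close>. Multiplied by 27,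
  the last inequality is \<open>(\<Phi> - 2 a)\<^sup>2 (\<Phi> + a) > 27 T\<close>, and together with \<open>\<Phi> - 2 a > 0\<close> it is \<open>\<Psi> > 0\<close>
  (\<open>exists_cold_energy_iff\<close>).
\<close>

section \<open>Velocity, pressure and energy as functions of \<open>\<rho> h W\<^sup>2\<close>\<close>

text \<open>
  The scalars \<open>M\<close>, \<open>b\<close>, \<open>s\<close> stand for \<open>|m|\<^sup>2\<close>, \<open>|B|\<^sup>2\<close> and \<open>m \<bullet> B\<close>; all that is left of the vectors is
  the Cauchy-Schwarz inequality between them.
\<close>

locale conserved_data =
  fixes D M b s :: real
  assumes D_pos: "D > 0" and M_nonneg: "M \<ge> 0" and b_nonneg: "b \<ge> 0"
    and cauchy_schwarz: "s\<^sup>2 \<le> M * b"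
begin

text \<open>
  This is \<open>|v|\<^sup>2\<close> for \<open>v = (m + (s / x) B) / (x + b)\<close>, the solution of the momentum equation
  \<open>m = (x + b) v - (v \<bullet> B) B\<close>, in which \<open>v \<bullet> B = s / x\<close>.
\<close>

definition speed_sq :: "real \<Rightarrow> real" where
  "speed_sq x = (M + s\<^sup>2 * (2 * x + b) / x\<^sup>2) / (x + b)\<^sup>2"

text \<open>
  The difference between \<open>1 / W\<^sup>2\<close> and its value \<open>(D / x)\<^sup>2\<close> at zero pressure: \<open>p = 0\<close> means \<open>h = 1\<close>, and
  then \<open>x = \<rho> W\<^sup>2 = D W\<close>.
\<close>

definition gap :: "real \<Rightarrow> real" where
  "gap x = 1 - speed_sq x - (D / x)\<^sup>2"

text \<open>
  The equation of state \<open>\<rho> h = \<rho> + p / k\<close> solved for \<open>p\<close>, with \<open>\<rho> h = x / W\<^sup>2\<close> and \<open>\<rho> = D / W\<close>.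
\<close>

definition pressure :: "real \<Rightarrow> real \<Rightarrow> real" where
  "pressure k x = k * (x * (1 - speed_sq x) - D * sqrt (1 - speed_sq x))"

definition energy :: "real \<Rightarrow> real \<Rightarrow> real" where
  "energy k x = x - pressure k x + b - (b * (1 - speed_sq x) + (s / x)\<^sup>2) / 2"

text \<open>
  The energy with the pressure dropped and \<open>1 / W\<^sup>2\<close> replaced by its zero-pressure value \<open>(D / x)\<^sup>2\<close>.
\<close>

definition cold_energy :: "real \<Rightarrow> real" where
  "cold_energy x = x + b - (b * D\<^sup>2 + s\<^sup>2) / (2 * x\<^sup>2)"

lemma speed_sq_nonneg: "x > 0 \<Longrightarrow> speed_sq x \<ge> 0"
  unfolding speed_sq_def using M_nonneg b_nonneg by auto

lemma speed_sq_antimono: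
  assumes "0 < x" "x \<le> y"
  shows "speed_sq y \<le> speed_sq x"
proof -
  have split: "s\<^sup>2 * (2 * z + b) / z\<^sup>2 = 2 * s\<^sup>2 / z + b * s\<^sup>2 / z\<^sup>2" if "z > 0" for z
    using that by (simp add: field_simps power2_eq_square)
  have "2 * s\<^sup>2 / y \<le> 2 * s\<^sup>2 / x"
    using assms by (intro divide_left_mono) auto
  moreover have "b * s\<^sup>2 / y\<^sup>2 \<le> b * s\<^sup>2 / x\<^sup>2"
    using assms b_nonneg by (intro divide_left_mono power_mono) auto
  ultimately have "s\<^sup>2 * (2 * y + b) / y\<^sup>2 \<le> s\<^sup>2 * (2 * x + b) / x\<^sup>2"
    using assms split[of x] split[of y] by linarith
  then show ?thesis
    unfolding speed_sq_def using assms M_nonneg b_nonneg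
    by (intro frac_le power_mono) (auto intro!: add_nonneg_nonneg)
qed

lemma gap_strict_mono:
  assumes "0 < x" "x < y"
  shows "gap x < gap y"
proof -
  have "D / y < D / x" using assms D_pos by (intro divide_strict_left_mono) auto
  then have "(D / y)\<^sup>2 < (D / x)\<^sup>2" using assms D_pos by (intro power_strict_mono) auto
  then show ?thesis using speed_sq_antimono[of x y] assms by (simp add: gap_def)
qed

text \<open>
  This supplies the lower end of the interval on which the zero of \<open>gap\<close> is found: \<open>x = D W h\<close>
  always exceeds \<open>D\<close> in an admissible state.
\<close>

lemma gap_at_D: "gap D \<le> 0"
  using speed_sq_nonneg[OF D_pos] D_pos by (simp add: gap_def)

lemma speed_sq_less_1:
  assumes "gap x \<ge> 0" "x > 0"
  shows "speed_sq x < 1"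
proof -
  have "(D / x)\<^sup>2 > 0" using assms D_pos by simp
  then show ?thesis using assms(1) unfolding gap_def by linarith
qed

lemma continuous_on_speed_sq: "continuous_on {0<..} speed_sq"
  unfolding speed_sq_def using b_nonneg by (intro continuous_intros) auto

lemma continuous_on_gap: "continuous_on {0<..} gap"
  unfolding gap_def by (intro continuous_intros continuous_on_speed_sq) auto

lemma continuous_on_energy: "continuous_on {0<..} (energy k)"
  unfolding energy_def pressure_def
  by (intro continuous_intros continuous_on_speed_sq) auto

lemma continuous_on_cold_energy: "continuous_on {0<..} cold_energy"
  unfolding cold_energy_def by (intro continuous_intros) auto

text \<open>
  With \<open>r = 1 / W\<close> the pressure factors as \<open>k r (x r - D)\<close>, so its sign is that of \<open>r - D / x\<close>,
  while \<open>gap\<close> is the difference of the squares \<open>r\<^sup>2 - (D / x)\<^sup>2\<close>.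
\<close>

lemma pressure_pos_iff:
  assumes "x > 0" "k > 0" "speed_sq x < 1"
  shows "pressure k x > 0 \<longleftrightarrow> gap x > 0"
proof -
  define r where "r = sqrt (1 - speed_sq x)"
  have r: "r > 0" "r\<^sup>2 = 1 - speed_sq x" using assms by (auto simp: r_def)
  have "pressure k x = k * r * (x * r - D)"
    unfolding pressure_def r_def[symmetric] unfolding r(2)[symmetric]
    by (simp add: power2_eq_square algebra_simps)
  moreover have "k * r > 0" using assms(2) r(1) by simp
  ultimately have "pressure k x > 0 \<longleftrightarrow> D < x * r"
    by (metis diff_gt_0_iff_gt mult_pos_pos zero_less_mult_pos)
  also have "\<dots> \<longleftrightarrow> D / x < r"
    using assms(1) by (simp add: pos_divide_less_eq mult.commute)
  also have "\<dots> \<longleftrightarrow> (D / x)\<^sup>2 < r\<^sup>2"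
    using assms(1) D_pos r(1)
    by (metis divide_pos_pos less_imp_le pos2 power_less_imp_less_base power_strict_mono)
  finally show ?thesis by (simp add: r(2) gap_def)
qed

text \<open>
  This is \<open>(v \<bullet> B)\<^sup>2 \<le> |v|\<^sup>2 |B|\<^sup>2\<close>, which in terms of \<open>x\<close> is a consequence of the Cauchy-Schwarz
  inequality for \<open>m\<close> and \<open>B\<close>. It bounds the magnetic pressure by \<open>b / 2\<close>.
\<close>

lemma magnetic_term_le:
  assumes "x > 0"
  shows "b * (1 - speed_sq x) + (s / x)\<^sup>2 \<le> b"
proof -
  have "s\<^sup>2 * (x + b)\<^sup>2 \<le> b * (M * x\<^sup>2 + s\<^sup>2 * (2 * x + b))"
  proof -
    have "s\<^sup>2 * x\<^sup>2 \<le> M * b * x\<^sup>2" using cauchy_schwarz by (intro mult_right_mono) auto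
    then show ?thesis by (simp add: power2_eq_square algebra_simps)
  qed
  then have "(s / x)\<^sup>2 \<le> b * speed_sq x"
    unfolding speed_sq_def using assms b_nonneg by (simp add: divide_simps add_pos_nonneg mult_ac)
  then show ?thesis by (simp add: algebra_simps)
qed

text \<open>
  The pressure is at most \<open>k x \<le> x / 2\<close> and the magnetic pressure at most \<open>b / 2\<close>; in
  particular the energy is unbounded as \<open>x\<close> grows.
\<close>

lemma energy_ge:
  assumes "x > 0" "0 < k" "k \<le> 1/2" "speed_sq x < 1"
  shows "energy k x \<ge> (x + b) / 2"
proof -
  have "pressure k x \<le> k * (x * 1)"
    unfolding pressure_def using assms speed_sq_nonneg[of x] D_pos
    by (intro mult_left_mono) (auto simp: algebra_simps intro: order_trans[of _ 0])
  also have "\<dots> \<le> 1/2 * x" using assms by (intro mult_mono) auto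
  finally show ?thesis using magnetic_term_le[OF assms(1)] unfolding energy_def by argo
qed

lemma cold_energy_eq:
  "x > 0 \<Longrightarrow> cold_energy x = x + b - (b * (D / x)\<^sup>2 + (s / x)\<^sup>2) / 2"
  by (simp add: cold_energy_def field_simps)

lemma cold_energy_pos:
  assumes "x > 0" "gap x > 0"
  shows "cold_energy x > 0"
proof -
  have "b * (D / x)\<^sup>2 \<le> b * (1 - speed_sq x)"
    using assms b_nonneg by (intro mult_left_mono) (auto simp: gap_def)
  then show ?thesis
    using assms magnetic_term_le[of x] b_nonneg by (simp add: cold_energy_eq)
qed

section \<open>Reduction to the pressure-free energy equation\<close>

text \<open>
  Both changes that lead from \<open>energy\<close> to \<open>cold_energy\<close> raise the value: dropping a positive
  pressure, and lowering \<open>1 / W\<^sup>2\<close> to \<open>(D / x)\<^sup>2\<close> in the magnetic pressure.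
\<close>

lemma energy_less_cold_energy:
  assumes "x > 0" "k > 0" "gap x > 0"
  shows "energy k x < cold_energy x"
proof -
  have "b * (D / x)\<^sup>2 \<le> b * (1 - speed_sq x)"
    using assms b_nonneg by (intro mult_left_mono) (auto simp: gap_def)
  moreover have "pressure k x > 0"
    using assms by (simp add: pressure_pos_iff speed_sq_less_1)
  ultimately show ?thesis unfolding cold_energy_eq[OF assms(1)] energy_def by argo
qed

lemma energy_eq_cold_energy:
  assumes "x > 0" "gap x = 0"
  shows "energy k x = cold_energy x"
proof -
  have w: "1 - speed_sq x = (D / x)\<^sup>2" using assms by (simp add: gap_def)
  have "sqrt (1 - speed_sq x) = D / x" using w assms D_pos by (simp add: real_sqrt_unique)
  then have "pressure k x = 0" using w assms by (simp add: pressure_def power2_eq_square)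
  then show ?thesis using w assms by (simp add: energy_def cold_energy_eq)
qed

text \<open>
  The first summand is the energy in the extreme case \<open>k = 1/2\<close>, \<open>D = 0\<close>. The other two are
  nondecreasing for \<open>0 < k \<le> 1/2\<close>, because \<open>speed_sq\<close> is nonincreasing, so that strict monotonicity
  of the energy needs to be checked in the extreme case only.
\<close>

lemma energy_decomposition:
  assumes "x > 0"
  shows "energy k x = ((x + b) + (M + s\<^sup>2 / x) / (x + b)) / 2
    + (1/2 - k) * (x * (1 - speed_sq x)) + k * D * sqrt (1 - speed_sq x)"
proof -
  have "(x + b) * speed_sq x - (s / x)\<^sup>2 = (M + s\<^sup>2 / x) / (x + b)"
    unfolding speed_sq_def using assms b_nonneg
    by (simp add: divide_simps add_pos_nonneg) (simp add: algebra_simps power2_eq_square)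
  then show ?thesis
    unfolding energy_def pressure_def by algebra
qed

text \<open>
  Twice the increment of the first summand of the decomposition from \<open>x\<close> to \<open>y\<close> is
  \<open>(y - x) (1 - S)\<close>, where \<open>S\<close> is a mixed form of \<open>speed_sq\<close> in \<open>x\<close> and \<open>y\<close>: it becomes
  \<open>speed_sq x\<close> when \<open>y = x\<close> and does not increase with \<open>y\<close>. Therefore \<open>S \<le> speed_sq x < 1\<close>.
\<close>

lemma energy_strict_mono:
  assumes "0 < x" "x < y" "0 < k" "k \<le> 1/2" "speed_sq x < 1"
  shows "energy k x < energy k y"
proof -
  have u: "speed_sq y \<le> speed_sq x" using assms by (intro speed_sq_antimono) auto
  have "(1/2 - k) * (x * (1 - speed_sq x)) \<le> (1/2 - k) * (y * (1 - speed_sq y))"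
    using assms u by (intro mult_left_mono mult_mono) auto
  moreover have "k * D * sqrt (1 - speed_sq x) \<le> k * D * sqrt (1 - speed_sq y)"
    using assms u D_pos by (intro mult_left_mono) auto
  moreover have "(x + b) + (M + s\<^sup>2 / x) / (x + b) < (y + b) + (M + s\<^sup>2 / y) / (y + b)"
  proof -
    define S where "S = M / ((x + b) * (y + b)) + s\<^sup>2 * (x + y + b) / (x * y * (x + b) * (y + b))"
    have "S \<le> speed_sq x"
    proof -
      have "M / ((x + b) * (y + b)) \<le> M / ((x + b) * (x + b))"
        using assms b_nonneg M_nonneg by (intro divide_left_mono mult_mono mult_pos_pos) auto
      moreover have "s\<^sup>2 * (x + y + b) / (x * y * (x + b) * (y + b))
          = s\<^sup>2 / (x * (x + b)) * (1 / y + x / (y * (y + b)))"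
        using assms b_nonneg by (simp add: divide_simps add_pos_nonneg)
      moreover have "\<dots> \<le> s\<^sup>2 / (x * (x + b)) * (1 / x + x / (x * (x + b)))"
        using assms b_nonneg
        by (intro mult_left_mono add_mono divide_left_mono mult_mono mult_pos_pos) auto
      moreover have "speed_sq x = M / ((x + b) * (x + b))
          + s\<^sup>2 / (x * (x + b)) * (1 / x + x / (x * (x + b)))"
        unfolding speed_sq_def using assms b_nonneg
        by (simp add: divide_simps add_pos_nonneg) (simp add: algebra_simps power2_eq_square)
      ultimately show ?thesis unfolding S_def by linarith
    qed
    then have "(y - x) * (1 - S) > 0" using assms by simp
    moreover have "(y + b) + (M + s\<^sup>2 / y) / (y + b) - ((x + b) + (M + s\<^sup>2 / x) / (x + b))
        = (y - x) * (1 - S)"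
      unfolding S_def using assms b_nonneg
      by (simp add: divide_simps add_pos_nonneg) (simp add: algebra_simps power2_eq_square)
    ultimately show ?thesis by linarith
  qed
  moreover have "0 < y" using assms by simp
  ultimately show ?thesis
    unfolding energy_decomposition[OF assms(1)] energy_decomposition[OF \<open>0 < y\<close>] by argo
qed

text \<open>
  Let \<open>x\<^sub>0\<close> be the zero of \<open>gap\<close>. Both energies agree there and \<open>energy k < cold_energy\<close> to its
  right. If \<open>energy k x = E\<close>, then \<open>cold_energy x\<^sub>0 = energy k x\<^sub>0 < E < cold_energy x\<close>, and
  \<open>cold_energy\<close> takes the value \<open>E\<close> between \<open>x\<^sub>0\<close> and \<open>x\<close>. If \<open>cold_energy x\<^sub>1 = E\<close>, then
  \<open>energy k x\<^sub>1 < E\<close>, and the unbounded function \<open>energy k\<close> takes the value \<open>E\<close> to the right of \<open>x\<^sub>1\<close>.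
\<close>

lemma exists_energy_iff_exists_cold_energy:
  assumes k: "0 < k" "k \<le> 1/2"
  shows "(\<exists>x>0. gap x > 0 \<and> energy k x = E) \<longleftrightarrow> (\<exists>x>0. gap x > 0 \<and> cold_energy x = E)"
proof
  assume "\<exists>x>0. gap x > 0 \<and> energy k x = E"
  then obtain x where x: "x > 0" "gap x > 0" "energy k x = E" by blast
  have "D < x"
    using gap_at_D gap_strict_mono[of x D] x by (cases "x = D") force+
  have "\<exists>x0. D \<le> x0 \<and> x0 \<le> x \<and> gap x0 = 0"
    using gap_at_D x \<open>D < x\<close> D_pos
    by (intro IVT' continuous_on_subset[OF continuous_on_gap]) auto
  then obtain x0 where x0: "D \<le> x0" "x0 \<le> x" "gap x0 = 0" by blast
  have x0': "x0 < x" "x0 > 0" using x x0 D_pos by (auto simp: less_le)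
  have lo: "cold_energy x0 < E"
    using energy_strict_mono[of x0 x k] energy_eq_cold_energy[of x0 k] x x0 x0' k speed_sq_less_1[of x0]
    by simp
  have hi: "E < cold_energy x"
    using energy_less_cold_energy[of x k] x k by simp
  have "\<exists>x1. x0 \<le> x1 \<and> x1 \<le> x \<and> cold_energy x1 = E"
    using lo hi x0' by (intro IVT' continuous_on_subset[OF continuous_on_cold_energy]) auto
  then obtain x1 where x1: "x0 \<le> x1" "x1 \<le> x" "cold_energy x1 = E" by blast
  then have "x0 < x1" using lo by (auto simp: less_le)
  then have "gap x1 > 0" using gap_strict_mono[of x0 x1] x0 x0' by simp
  then show "\<exists>x>0. gap x > 0 \<and> cold_energy x = E" using x1 x0' \<open>x0 < x1\<close> by (intro exI[of _ x1]) auto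
next
  assume "\<exists>x>0. gap x > 0 \<and> cold_energy x = E"
  then obtain x1 where x1: "x1 > 0" "gap x1 > 0" "cold_energy x1 = E" by blast
  \<comment> \<open>The factor 2 matches the lower bound \<open>(y + b) / 2\<close> for the energy at \<open>y\<close>.\<close>
  define y where "y = max x1 (2 * E)"
  have gap_pos: "gap z > 0" if "x1 \<le> z" for z
    using gap_strict_mono[of x1 z] x1 that by (cases "x1 = z") auto
  have y: "y > 0" "x1 \<le> y" "2 * E \<le> y" using x1 by (auto simp: y_def)
  have "speed_sq y < 1" using gap_pos[OF y(2)] y by (intro speed_sq_less_1) auto
  then have "E \<le> energy k y"
    using energy_ge[of y k] y k b_nonneg by simp
  moreover have "energy k x1 \<le> E"
    using energy_less_cold_energy[of x1 k] x1 k by simp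
  ultimately have "\<exists>x. x1 \<le> x \<and> x \<le> y \<and> energy k x = E"
    using x1 y by (intro IVT' continuous_on_subset[OF continuous_on_energy]) auto
  then obtain x where "x1 \<le> x" "x \<le> y" "energy k x = E" by blast
  then show "\<exists>x>0. gap x > 0 \<and> energy k x = E"
    using gap_pos[of x] x1 by (intro exI[of _ x]) auto
qed

section \<open>The cubic equation and its comparison with \<open>\<Psi>\<close>\<close>

lemma cold_energy_eq_iff_cubic:
  "x > 0 \<Longrightarrow> cold_energy x = E \<longleftrightarrow> x\<^sup>2 * (x + (b - E)) = (b * D\<^sup>2 + s\<^sup>2) / 2"
  unfolding cold_energy_def by (simp add: field_simps)

text \<open>
  The product \<open>x\<^sup>2 (x + b)\<^sup>2 gap x\<close> is a quartic polynomial in which \<open>D\<close> and \<open>s\<close> occur, besides in the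
  coefficient of \<open>x\<^sup>2\<close>, through \<open>T = (b D\<^sup>2 + s\<^sup>2) / 2\<close> only. Substituting \<open>T = x\<^sup>2 (x + b - E)\<close> makes it
  divisible by \<open>x\<^sup>2\<close> and leaves a quadratic polynomial.
\<close>

lemma gap_at_cold_energy:
  assumes "x > 0" "cold_energy x = E"
  shows "gap x > 0 \<longleftrightarrow> (3 * x + (b - E)) * (x + (b - E)) < E\<^sup>2 - D\<^sup>2 - M"
proof -
  define T where "T = (b * D\<^sup>2 + s\<^sup>2) / 2"
  have T: "T = x\<^sup>2 * (x + (b - E))" using assms by (simp add: cold_energy_eq_iff_cubic T_def)
  have s: "s\<^sup>2 = 2 * T - b * D\<^sup>2" by (simp add: T_def field_simps)
  have "x\<^sup>2 * (x + b)\<^sup>2 * gap x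
      = (x\<^sup>2 - D\<^sup>2) * (x + b)\<^sup>2 - M * x\<^sup>2 - (2 * x + b) * s\<^sup>2"
    unfolding gap_def speed_sq_def using assms(1) b_nonneg
    by (simp add: divide_simps add_pos_nonneg) (simp add: algebra_simps power2_eq_square)
  also have "\<dots> = x\<^sup>2 * (E\<^sup>2 - D\<^sup>2 - M - (3 * x + (b - E)) * (x + (b - E)))"
    unfolding s T by (simp add: algebra_simps power2_eq_square)
  finally have "(x + b)\<^sup>2 * gap x = E\<^sup>2 - D\<^sup>2 - M - (3 * x + (b - E)) * (x + (b - E))"
    using assms(1) by simp
  moreover have "(x + b)\<^sup>2 > 0" using assms(1) b_nonneg by simp
  ultimately show ?thesis by (metis diff_gt_0_iff_gt zero_less_mult_pos mult_pos_pos)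
qed

text \<open>
  For \<open>L = E\<^sup>2 - D\<^sup>2 - M\<close>, the inequality \<open>(3 x + a) (x + a) < L\<close> is \<open>(3 x + 2 a)\<^sup>2 < a\<^sup>2 + 3 L = \<Phi>\<^sup>2\<close>
  after completing the square, so it confines \<open>x\<close> to an interval with right end \<open>z\<close>. A
  positive root of the cubic satisfies \<open>x + a \<ge> 0\<close>, since \<open>T \<ge> 0\<close>; it follows that the left side
  is nonnegative, which forces \<open>L > 0\<close> and hence \<open>q > 0\<close>, and conversely that for \<open>L > 0\<close> the left
  end of the interval is no restriction. On \<open>x \<ge> max 0 (- a)\<close> the cubic is increasing, so
  \<open>x < z\<close> amounts to \<open>T < z\<^sup>2 (z + a)\<close>.
\<close>

lemma exists_cold_energy_iff:
  defines "f \<equiv> \<lambda>E. sqrt ((b - E)\<^sup>2 + 3 * (E\<^sup>2 - D\<^sup>2 - M))"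
  shows "(\<exists>x>0. gap x > 0 \<and> cold_energy x = E) \<longleftrightarrow>
    E - sqrt (D\<^sup>2 + M) > 0 \<and>
    (f E - 2 * (b - E)) * sqrt (f E + b - E) - sqrt (27 / 2 * (D\<^sup>2 * b + s\<^sup>2)) > 0"
proof -
  define a where "a = b - E"
  define T where "T = (b * D\<^sup>2 + s\<^sup>2) / 2"
  define L where "L = E\<^sup>2 - D\<^sup>2 - M"
  define F where "F = f E"
  define z where "z = (F - 2 * a) / 3"
  have T_nonneg: "T \<ge> 0" using b_nonneg by (simp add: T_def)
  have F_eq: "F = sqrt (a\<^sup>2 + 3 * L)" by (simp add: F_def f_def a_def L_def)
  have F_z: "F - 2 * a = 3 * z" "F + a = 3 * (z + a)" by (auto simp: z_def field_simps)
  have psi: "(f E - 2 * (b - E)) * sqrt (f E + b - E) - sqrt (27 / 2 * (D\<^sup>2 * b + s\<^sup>2))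
      = 3 * z * sqrt (3 * (z + a)) - sqrt (27 * T)"
  proof -
    have "f E - 2 * (b - E) = 3 * z" "f E + b - E = 3 * (z + a)"
      using F_z by (simp_all add: F_def a_def)
    moreover have "27 / 2 * (D\<^sup>2 * b + s\<^sup>2) = 27 * T" by (simp add: T_def mult.commute)
    ultimately show ?thesis by simp
  qed
  have q: "E - sqrt (D\<^sup>2 + M) > 0 \<longleftrightarrow> E > 0 \<and> L > 0"
  proof -
    have "sqrt (D\<^sup>2 + M) < E \<longleftrightarrow> E > 0 \<and> D\<^sup>2 + M < E\<^sup>2"
    proof (cases "E > 0")
      case True
      then show ?thesis by (metis real_less_lsqrt less_imp_le real_sqrt_abs real_sqrt_less_iff abs_of_pos)
    next
      case False
      moreover have "sqrt (D\<^sup>2 + M) \<ge> 0" using M_nonneg by simp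
      ultimately show ?thesis by linarith
    qed
    then show ?thesis by (auto simp: L_def)
  qed
  have cubic: "cold_energy x = E \<longleftrightarrow> x\<^sup>2 * (x + a) = T" if "x > 0" for x
    using cold_energy_eq_iff_cubic[OF that] by (simp add: a_def T_def)
  have gap: "gap x > 0 \<longleftrightarrow> (3 * x + a) * (x + a) < L" if "x > 0" "cold_energy x = E" for x
    using gap_at_cold_energy[OF that] by (simp add: a_def L_def)
  have square: "(3 * x + a) * (x + a) < L \<longleftrightarrow> (3 * x + 2 * a)\<^sup>2 < a\<^sup>2 + 3 * L" for x
    by (simp add: power2_eq_square algebra_simps) linarith
  have bounds: "(3 * x + a) * (x + a) < L \<longleftrightarrow> \<bar>3 * x + 2 * a\<bar> < F" for x
    unfolding square F_eq by (metis real_sqrt_abs real_sqrt_less_iff)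
  have "(\<exists>x>0. gap x > 0 \<and> cold_energy x = E) \<longleftrightarrow> (E > 0 \<and> L > 0) \<and> sqrt (27 * T) < 3 * z * sqrt (3 * (z + a))"
  proof
    assume "\<exists>x>0. gap x > 0 \<and> cold_energy x = E"
    then obtain x where x: "x > 0" "gap x > 0" "cold_energy x = E" by blast
    have eq: "x\<^sup>2 * (x + a) = T" using cubic x by simp
    then have xa: "x + a \<ge> 0" using T_nonneg x(1) by (metis zero_le_mult_iff zero_less_power not_less)
    have ineq: "(3 * x + a) * (x + a) < L" using gap x by simp
    moreover have "(3 * x + a) * (x + a) \<ge> 0" using xa x by simp
    ultimately have "L > 0" by linarith
    have "x < z" using ineq bounds[of x] by (simp add: z_def)
    have "T < z\<^sup>2 * (z + a)"
    proof -
      have "T \<le> z\<^sup>2 * (x + a)"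
        unfolding eq[symmetric] using x xa \<open>x < z\<close> by (intro mult_right_mono power_mono) auto
      also have "\<dots> < z\<^sup>2 * (z + a)" using x \<open>x < z\<close> by simp
      finally show ?thesis .
    qed
    then have "sqrt (27 * T) < sqrt ((3 * z)\<^sup>2 * (3 * (z + a)))"
      by (simp add: power_mult_distrib del: distrib_left_numeral)
    also have "\<dots> = 3 * z * sqrt (3 * (z + a))"
      using x \<open>x < z\<close> by (simp add: real_sqrt_mult)
    finally show "(E > 0 \<and> L > 0) \<and> sqrt (27 * T) < 3 * z * sqrt (3 * (z + a))"
      using \<open>L > 0\<close> cold_energy_pos[OF x(1,2)] x by simp
  next
    assume "(E > 0 \<and> L > 0) \<and> sqrt (27 * T) < 3 * z * sqrt (3 * (z + a))"
    then have E: "E > 0" and L: "L > 0" and psi_pos: "sqrt (27 * T) < 3 * z * sqrt (3 * (z + a))"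
      by auto
    have F_gt: "F > \<bar>a\<bar>" unfolding F_eq using L by (intro real_less_rsqrt) simp
    have "F + a > 0" using F_gt by linarith
    then have za: "z + a > 0" unfolding F_z(2) by simp
    have "0 \<le> sqrt (27 * T)" using T_nonneg by simp
    then have "3 * z * sqrt (3 * (z + a)) > 0" using psi_pos by linarith
    then have z: "z > 0" using za by (simp add: zero_less_mult_iff)
    have "sqrt (27 * T) < sqrt ((3 * z)\<^sup>2 * (3 * (z + a)))"
      using psi_pos z by (simp add: real_sqrt_mult)
    then have Tz: "T < z\<^sup>2 * (z + a)" by (simp add: power_mult_distrib del: distrib_left_numeral)
    \<comment> \<open>The larger zero of \<open>x\<^sup>2 (x + a)\<close>, the left end of its increasing nonnegative branch.\<close>
    define lo where "lo = max 0 (- a)"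
    have lo: "lo\<^sup>2 * (lo + a) = 0" "0 \<le> lo" "- a \<le> lo" "lo \<le> z" using z za by (auto simp: lo_def max_def)
    have "\<exists>x. lo \<le> x \<and> x \<le> z \<and> x\<^sup>2 * (x + a) = T"
      using lo Tz T_nonneg by (intro IVT' continuous_intros) auto
    then obtain x where x: "lo \<le> x" "x \<le> z" "x\<^sup>2 * (x + a) = T" by blast
    have "x \<noteq> z" using x Tz by auto
    \<comment> \<open>If \<open>T = 0\<close>, the root could be 0 for \<open>a \<ge> 0\<close>; but \<open>T = 0\<close> means \<open>b = 0\<close>, and then \<open>a = - E < 0\<close>.\<close>
    have x_pos: "x > 0"
    proof (cases "b = 0")
      case True
      then show ?thesis using E x lo by (simp add: a_def)
    next
      case False
      then have "T > 0" using b_nonneg D_pos by (auto simp: T_def intro!: add_pos_nonneg)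
      then show ?thesis using x lo by (cases "x = 0") auto
    qed
    have "\<bar>3 * x + 2 * a\<bar> < F"
      using x \<open>x \<noteq> z\<close> x_pos lo F_gt F_z by (auto simp: abs_if split: if_splits)
    then have "gap x > 0" "cold_energy x = E" using bounds gap cubic x x_pos by auto
    then show "\<exists>x>0. gap x > 0 \<and> cold_energy x = E" using x_pos by blast
  qed
  then show ?thesis unfolding psi q by simp
qed

end

section \<open>Recovering the primitive variables\<close>

lemma conserved_data_vectors:
  fixes m B :: "real^3"
  assumes "D > 0"
  shows "conserved_data D ((norm m)\<^sup>2) ((norm B)\<^sup>2) (m \<bullet> B)"
proof
  show "(m \<bullet> B)\<^sup>2 \<le> (norm m)\<^sup>2 * (norm B)\<^sup>2"
    using Cauchy_Schwarz_ineq[of m B] by (simp add: power2_norm_eq_inner)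
qed (use assms in auto)

text \<open>
  The point is that \<open>v \<bullet> B = (m \<bullet> B) / x\<close>, since the coefficient of \<open>m \<bullet> B\<close> in the inner product of
  the formula for \<open>v\<close> with \<open>B\<close> is \<open>(1 + |B|\<^sup>2 / x) / (x + |B|\<^sup>2) = 1 / x\<close>.
\<close>

lemma momentum_of_velocity:
  fixes v m B :: "real^3"
  assumes "x > 0" and v: "v = (1 / (x + (norm B)\<^sup>2)) *\<^sub>R (m + ((m \<bullet> B) / x) *\<^sub>R B)"
  shows "m = x *\<^sub>R v + (norm B)\<^sup>2 *\<^sub>R v - (v \<bullet> B) *\<^sub>R B"
proof -
  define b where "b = (norm B)\<^sup>2"
  have b: "B \<bullet> B = b" "b \<ge> 0" by (auto simp: b_def power2_norm_eq_inner)
  have xb: "x + b > 0" using assms(1) b by simp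
  have v': "v = (1 / (x + b)) *\<^sub>R (m + ((m \<bullet> B) / x) *\<^sub>R B)" using v by (simp add: b_def)
  have "v \<bullet> B = (m \<bullet> B + (m \<bullet> B) / x * b) / (x + b)" unfolding v' by (simp add: inner_simps b)
  also have "\<dots> = ((m \<bullet> B) / x * (x + b)) / (x + b)" using assms(1) by (simp add: distrib_left)
  also have "\<dots> = (m \<bullet> B) / x" using xb by simp
  finally have vB: "v \<bullet> B = (m \<bullet> B) / x" .
  have "(x + b) *\<^sub>R v = m + ((m \<bullet> B) / x) *\<^sub>R B" using v' xb by simp
  then show ?thesis by (simp add: vB scaleR_add_left[symmetric] flip: b_def)
qed

lemma velocity_speed_sq:
  fixes v m B :: "real^3"
  assumes "(D::real) > 0" "x > 0" and m: "m = x *\<^sub>R v + (norm B)\<^sup>2 *\<^sub>R v - (v \<bullet> B) *\<^sub>R B"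
  shows "conserved_data.speed_sq ((norm m)\<^sup>2) ((norm B)\<^sup>2) (m \<bullet> B) x = (norm v)\<^sup>2"
    and "(m \<bullet> B) / x = v \<bullet> B"
proof -
  interpret conserved_data D "(norm m)\<^sup>2" "(norm B)\<^sup>2" "m \<bullet> B"
    using assms(1) by (rule conserved_data_vectors)
  show s: "(m \<bullet> B) / x = v \<bullet> B"
    using assms(2) by (simp add: m inner_simps power2_norm_eq_inner)
  have "(x + (norm B)\<^sup>2) *\<^sub>R v = m + ((m \<bullet> B) / x) *\<^sub>R B"
    unfolding s by (subst m) (simp add: scaleR_add_left)
  then have "(x + (norm B)\<^sup>2)\<^sup>2 * (norm v)\<^sup>2 = (norm (m + ((m \<bullet> B) / x) *\<^sub>R B))\<^sup>2"
    by (metis norm_scaleR power2_abs power_mult_distrib)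
  also have "\<dots> = (norm m)\<^sup>2 + (m \<bullet> B)\<^sup>2 * (2 * x + (norm B)\<^sup>2) / x\<^sup>2"
    unfolding power2_norm_eq_inner using assms(2)
    by (simp add: inner_add_left inner_add_right inner_commute[of B m])
      (simp add: field_simps power2_eq_square)
  finally show "speed_sq x = (norm v)\<^sup>2"
    unfolding speed_sq_def using assms(2) b_nonneg
    by (metis add_pos_nonneg less_numeral_extra(3) nonzero_mult_div_cancel_left zero_less_power)
qed

lemma rho_enthalpy:
  assumes "1 < \<Gamma>" "\<rho> > 0"
  shows "\<rho> * enthalpy \<Gamma> \<rho> p = \<rho> + p / ((\<Gamma> - 1) / \<Gamma>)"
  using assms by (simp add: enthalpy_def internal_energy_def field_simps)

text \<open>
  From primitive variables, \<open>x = \<rho> h W\<^sup>2\<close> is a solution. Conversely a solution \<open>x\<close> gives the velocity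
  by the formula behind \<open>speed_sq\<close>, the density \<open>D / W\<close> and the pressure \<open>pressure k x\<close>, which is
  positive because \<open>gap x\<close> is; these reproduce the mass density and momentum by construction and
  the energy by the equation that \<open>x\<close> solves.
\<close>

lemma admissible_iff:
  fixes m B :: "real^3"
  assumes "1 < \<Gamma>"
  shows "(D, m, B, E) \<in> admissible \<Gamma> \<longleftrightarrow> D > 0 \<and>
    (\<exists>x>0. conserved_data.gap D ((norm m)\<^sup>2) ((norm B)\<^sup>2) (m \<bullet> B) x > 0 \<and>
      conserved_data.energy D ((norm m)\<^sup>2) ((norm B)\<^sup>2) (m \<bullet> B) ((\<Gamma> - 1) / \<Gamma>) x = E)"
    (is "?L \<longleftrightarrow> D > 0 \<and> ?R")
proof -
  define k where "k = (\<Gamma> - 1) / \<Gamma>"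
  have k: "k > 0" using assms by (simp add: k_def)
  have "?L \<longleftrightarrow> ?R" if "D > 0"
  proof -
    interpret conserved_data D "(norm m)\<^sup>2" "(norm B)\<^sup>2" "m \<bullet> B"
      using that by (rule conserved_data_vectors)
    show ?thesis
    proof
      assume ?L
      then obtain \<rho> v B' p where V: "\<rho> > 0" "p > 0" "norm v < 1"
        and U': "(D, m, B, E) = conservative_of \<Gamma> (\<rho>, v, B', p)"
        unfolding admissible_def by blast
      have "B' = B" using U' by (simp add: Let_def)
      then have U: "(D, m, B, E) = conservative_of \<Gamma> (\<rho>, v, B, p)" using U' by simp
      define w where "w = 1 - (norm v)\<^sup>2"
      have w: "w > 0" using V(3) by (simp add: w_def power_less_one_iff)
      define r where "r = sqrt w"
      have r: "r > 0" "r\<^sup>2 = w" using w by (simp_all add: r_def)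
      define x where "x = (\<rho> + p / k) / w"
      have x: "x > 0" using V k w by (simp add: x_def add_pos_pos)
      have W: "lorentz_factor v = 1 / r" by (simp add: lorentz_factor_def r_def w_def)
      have xW: "\<rho> * enthalpy \<Gamma> \<rho> p * (lorentz_factor v)\<^sup>2 = x"
        using rho_enthalpy[OF assms V(1), of p] by (simp add: W power_divide r x_def k_def)
      have D: "D = \<rho> / r" and m: "m = x *\<^sub>R v + (norm B)\<^sup>2 *\<^sub>R v - (v \<bullet> B) *\<^sub>R B"
        and E: "E = x - total_pressure v B p + (norm B)\<^sup>2"
        using U by (simp_all only: conservative_of.simps Let_def prod.inject xW) (simp add: W)
      note vel = velocity_speed_sq[OF that x m]
      have p: "pressure k x = p"
        using r w k by (simp add: pressure_def vel flip: w_def r_def)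
          (simp add: x_def D field_simps)
      have "gap x > 0"
        using pressure_pos_iff[OF x k] V vel w by (simp add: p w_def)
      moreover have "energy k x = E"
        unfolding energy_def p E total_pressure_def magnetic_pressure_def W vel
        by (simp add: r w_def power_divide field_simps)
      ultimately show ?R using x unfolding k_def by blast
    next
      assume ?R
      then obtain x where x: "x > 0" "gap x > 0" "energy k x = E" unfolding k_def by blast
      define v where "v = (1 / (x + (norm B)\<^sup>2)) *\<^sub>R (m + ((m \<bullet> B) / x) *\<^sub>R B)"
      have m: "m = x *\<^sub>R v + (norm B)\<^sup>2 *\<^sub>R v - (v \<bullet> B) *\<^sub>R B"
        using momentum_of_velocity[OF x(1) v_def] .
      note vel = velocity_speed_sq[OF that x(1) m]
      define w where "w = 1 - (norm v)\<^sup>2"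
      have u: "speed_sq x < 1" using x by (simp add: speed_sq_less_1)
      then have w: "w > 0" by (simp add: w_def vel)
      define r where "r = sqrt w"
      have r: "r > 0" "r\<^sup>2 = w" using w by (simp_all add: r_def)
      define p where "p = pressure k x"
      have p: "p > 0" using x k u by (simp add: p_def pressure_pos_iff)
      have "norm v < 1" using w by (simp add: w_def power_less_one_iff abs_square_less_1)
      moreover have "D * r > 0" using that r by simp
      moreover have W: "lorentz_factor v = 1 / r" by (simp add: lorentz_factor_def r_def w_def)
      moreover have xW: "D * r * enthalpy \<Gamma> (D * r) p * (lorentz_factor v)\<^sup>2 = x"
      proof -
        have "p = k * (x * w - D * r)" by (simp add: p_def pressure_def vel w_def r_def)
        then show ?thesis
          using rho_enthalpy[OF assms \<open>D * r > 0\<close>, of p] k w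
          by (simp add: W power_divide r flip: k_def)
      qed
      moreover have "E = x - total_pressure v B p + (norm B)\<^sup>2"
        unfolding x(3)[symmetric] energy_def total_pressure_def magnetic_pressure_def W vel p_def
        by (simp add: r w_def power_divide field_simps)
      ultimately have "(D, m, B, E) = conservative_of \<Gamma> (D * r, v, B, p)"
        using m r by (simp only: conservative_of.simps Let_def xW) simp
      then show ?L unfolding admissible_def
        using \<open>norm v < 1\<close> \<open>D * r > 0\<close> p by blast
    qed
  qed
  moreover have "D > 0" if adm: ?L
  proof -
    obtain \<rho> v B' p where "\<rho> > 0" "norm v < 1" "(D, m, B, E) = conservative_of \<Gamma> (\<rho>, v, B', p)"
      using adm unfolding admissible_def by blast
    then have "\<rho> > 0" "norm v < 1" "D = \<rho> * lorentz_factor v" by (auto simp: Let_def)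
    then show ?thesis by (simp add: lorentz_factor_def power_less_one_iff abs_square_less_1)
  qed
  ultimately show ?thesis by blast
qed

section \<open>The admissible set\<close>

theorem theorem2p1:
  fixes \<Gamma> :: real
  assumes "1 < \<Gamma>" and "\<Gamma> \<le> 2"
  shows "admissible \<Gamma> = G0"
proof -
  have k: "0 < (\<Gamma> - 1) / \<Gamma>" "(\<Gamma> - 1) / \<Gamma> \<le> 1/2"
    using assms by (auto simp: field_simps)
  have "(D, m, B, E) \<in> admissible \<Gamma> \<longleftrightarrow> (D, m, B, E) \<in> G0" for D m B E
  proof (cases "D > 0")
    case True
    interpret conserved_data D "(norm m)\<^sup>2" "(norm B)\<^sup>2" "m \<bullet> B"
      using True by (rule conserved_data_vectors)
    show ?thesis
      unfolding admissible_iff[OF assms(1)] exists_energy_iff_exists_cold_energy[OF k]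
        exists_cold_energy_iff
      using True by (simp add: G0_def)
  next
    case False
    then show ?thesis by (simp add: admissible_iff[OF assms(1)] G0_def)
  qed
  then show ?thesis by auto
qed

end
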